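(* Let $Q=sat(t,t')$ be a query, where $t$ is a list of lists of elements of the form $s-s'$ and $t'$ is a list (the terms may contain variables). Then, under every selection rule, each SLD-tree for $P_3$ and $Q$ is finite.
   Context: Prolog list notation is used ($[\,]$ is a constant, $[h|t]$ a binary constructor); a list is a term of the form $[t_1,\ldots,t_n]$, $n\ge0$ (so ending in $[\,]$), with arbitrary, possibly non-ground, elements. The symbol $-$ is a binary function symbol written infix; $\mathtt{true},\mathtt{false}$ are constants. SLD-resolution and SLD-trees are as usual in definite clause logic programming. The definite clause program $P_3$ consists of the following rules (names beginning with upper-case letters are variables): 1. $sat\_cnf([\,])$. 2. $sat\_cnf([C|Cs])\gets sat\_cl(C), sat\_cnf(Cs)$. 3. $sat\_cl([P-V|R])\gets sat\_cl3(R,V,P)$. 4. ${=}(X,X)$. 5. $sat\_cl3([\,],V,P)\gets V=P$. 6. $sat\_cl3([P_2-V_2|R],V_1,P_1)\gets sat\_cl5(V_1,P_1,V_2,P_2,R)$. 7. $sat\_cl5(V_1,P_1,V_2,P_2,R)\gets sat\_cl5a(V_1,P_1,V_2,P_2,R)$. 8. $sat\_cl5(V_1,P_1,V_2,P_2,R)\gets sat\_cl5a(V_2,P_2,V_1,P_1,R)$. 9. $sat\_cl5a(V_1,P_1,V_2,P_2,R)\gets V_1=P_1$. 10. $sat\_cl5a(V_1,P_1,V_2,P_2,R)\gets sat\_cl3(R,V_2,P_2)$. 11. $sat(Cs,Vs)\gets sat\_cnf(Cs), tflist(Vs)$. 12. $tflist([\,])$. 13. $tflist([V|Vs])\gets tflist(Vs),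 tf(V)$. 14. $tf(\mathtt{true})$. 15. $tf(\mathtt{false})$. *)

theory Defs
  imports Main
begin

datatype ('f, vars_trm: 'v) trm = Var 'v | Fun 'f "('f, 'v) trm list"

datatype ('p, 'f, vars_atom: 'v) atom = Atom 'p "('f, 'v) trm list"

datatype ('p, 'f, vars_clause: 'v) clause =
  Clause (head: "('p, 'f, 'v) atom") (body: "('p, 'f, 'v) atom list")

type_synonym ('p, 'f, 'v) query = "('p, 'f, 'v) atom list"

definition vars_query :: "('p, 'f, 'v) query \<Rightarrow> 'v set" where
  "vars_query G = (\<Union>A \<in> set G. vars_atom A)"

type_synonym ('f, 'v) subst = "'v \<Rightarrow> ('f, 'v) trm"

definition subst_domain :: "('f, 'v) subst \<Rightarrow> 'v set" where
  "subst_domain \<sigma> = {x. \<sigma> x \<noteq> Var x}"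

definition vars_subst :: "('f, 'v) subst \<Rightarrow> 'v set" where
  "vars_subst \<sigma> = subst_domain \<sigma> \<union> (\<Union>x \<in> subst_domain \<sigma>. vars_trm (\<sigma> x))"

definition is_substitution :: "('f, 'v) subst \<Rightarrow> bool" where
  "is_substitution \<sigma> \<longleftrightarrow> finite (subst_domain \<sigma>)"

fun subst_trm :: "('f, 'v) trm \<Rightarrow> ('f, 'v) subst \<Rightarrow> ('f, 'v) trm" where
  "subst_trm (Var x) \<sigma> = \<sigma> x"
| "subst_trm (Fun f ts) \<sigma> = Fun f (map (\<lambda>t. subst_trm t \<sigma>) ts)"

fun subst_atom :: "('p, 'f, 'v) atom \<Rightarrow> ('f, 'v) subst \<Rightarrow> ('p, 'f, 'v) atom" where
  "subst_atom (Atom p ts) \<sigma> = Atom p (map (\<lambda>t. subst_trm t \<sigma>) ts)"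

definition subst_query :: "('p, 'f, 'v) query \<Rightarrow> ('f, 'v) subst \<Rightarrow> ('p, 'f, 'v) query" where
  "subst_query G \<sigma> = map (\<lambda>A. subst_atom A \<sigma>) G"

definition subst_clause :: "('p, 'f, 'v) clause \<Rightarrow> ('f, 'v) subst \<Rightarrow> ('p, 'f, 'v) clause" where
  "subst_clause c \<sigma> = Clause (subst_atom (head c) \<sigma>) (subst_query (body c) \<sigma>)"

text \<open>\<open>subst_comp \<sigma> \<tau>\<close> applies \<open>\<sigma>\<close> first.\<close>

definition subst_comp :: "('f, 'v) subst \<Rightarrow> ('f, 'v) subst \<Rightarrow> ('f, 'v) subst" where
  "subst_comp \<sigma> \<tau> = (\<lambda>x. subst_trm (\<sigma> x) \<tau>)"

definition is_renaming :: "('f, 'v) subst \<Rightarrow> bool" where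
  "is_renaming \<rho> \<longleftrightarrow> is_substitution \<rho> \<and> (\<exists>\<pi>. bij \<pi> \<and> \<rho> = (\<lambda>x. Var (\<pi> x)))"

definition is_variant :: "('p, 'f, 'v) clause \<Rightarrow> ('p, 'f, 'v) clause \<Rightarrow> bool" where
  "is_variant c' c \<longleftrightarrow> (\<exists>\<rho>. is_renaming \<rho> \<and> c' = subst_clause c \<rho>)"

definition is_unifier ::
  "('f, 'v) subst \<Rightarrow> ('p, 'f, 'v) atom \<Rightarrow> ('p, 'f, 'v) atom \<Rightarrow> bool" where
  "is_unifier \<theta> A B \<longleftrightarrow> is_substitution \<theta> \<and> subst_atom A \<theta> = subst_atom B \<theta>"

definition is_mgu ::
  "('f, 'v) subst \<Rightarrow> ('p, 'f, 'v) atom \<Rightarrow> ('p, 'f, 'v) atom \<Rightarrow> bool" where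
  "is_mgu \<theta> A B \<longleftrightarrow> is_unifier \<theta> A B \<and>
     (\<forall>\<tau>. is_unifier \<tau> A B \<longrightarrow> (\<exists>\<delta>. is_substitution \<delta> \<and> \<tau> = subst_comp \<theta> \<delta>))"

text \<open>
  A step records the position of the selected atom, the program clause used, the
  (standardized apart) variant of it that serves as the input clause, the mgu, and the
  resulting query.  A finite SLD-derivation is an initial query with a list of steps.
\<close>

datatype ('p, 'f, 'v) step = Step
  (selected: nat)
  (pclause: "('p, 'f, 'v) clause")
  (input: "('p, 'f, 'v) clause")
  (mgu: "('f, 'v) subst")
  (resolvent: "('p, 'f, 'v) query")

definition last_query ::
  "('p, 'f, 'v) query \<Rightarrow> ('p, 'f, 'v) step list \<Rightarrow> ('p, 'f, 'v) query" where
  "last_query Q ss = (if ss = [] then Q else resolvent (last ss))"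

definition used_vars ::
  "('p, 'f, 'v) query \<Rightarrow> ('p, 'f, 'v) step list \<Rightarrow> 'v set" where
  "used_vars Q ss = vars_query Q \<union> (\<Union>s \<in> set ss. vars_clause (input s) \<union> vars_subst (mgu s))"

definition sld_step ::
  "('p, 'f, 'v) clause set \<Rightarrow> ('p, 'f, 'v) query \<Rightarrow> ('p, 'f, 'v) step list
    \<Rightarrow> ('p, 'f, 'v) step \<Rightarrow> bool" where
  "sld_step P Q ss s \<longleftrightarrow>
     (let G = last_query Q ss; i = selected s in
        i < length G \<and>
        pclause s \<in> P \<and>
        is_variant (input s) (pclause s) \<and>
        vars_clause (input s) \<inter> used_vars Q ss = {} \<and>
        is_mgu (mgu s) (G ! i) (head (input s)) \<and>
        resolvent s = subst_query (take i G @ body (input s) @ drop (Suc i) G) (mgu s))"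

inductive sld_derivation ::
  "('p, 'f, 'v) clause set \<Rightarrow> ('p, 'f, 'v) query \<Rightarrow> ('p, 'f, 'v) step list \<Rightarrow> bool"
  for P Q where
  start: "sld_derivation P Q []"
| extend: "sld_derivation P Q ss \<Longrightarrow> sld_step P Q ss s \<Longrightarrow> sld_derivation P Q (ss @ [s])"

text \<open>A selection rule may depend on the whole derivation constructed so far.\<close>

type_synonym ('p, 'f, 'v) selection =
  "('p, 'f, 'v) query \<Rightarrow> ('p, 'f, 'v) step list \<Rightarrow> nat"

definition selection_rule ::
  "('p, 'f, 'v) clause set \<Rightarrow> ('p, 'f, 'v) selection \<Rightarrow> bool" where
  "selection_rule P R \<longleftrightarrow>
     (\<forall>Q ss. sld_derivation P Q ss \<and> last_query Q ss \<noteq> [] \<longrightarrow> R Q ss < length (last_query Q ss))"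

definition applicable :: "('p, 'f, 'v) clause \<Rightarrow> ('p, 'f, 'v) atom \<Rightarrow> bool" where
  "applicable c A \<longleftrightarrow>
     (\<exists>c' \<theta>. is_variant c' c \<and> vars_clause c' \<inter> vars_atom A = {} \<and> is_unifier \<theta> A (head c'))"

text \<open>
  A tree is represented by its set of nodes, a node being identified with the derivation
  leading to it from the root \<open>Q\<close>.  So the tree is finite iff the set is finite, and the
  node \<open>ss\<close> is labelled with \<open>last_query Q ss\<close>.
\<close>

definition sld_tree ::
  "('p, 'f, 'v) clause set \<Rightarrow> ('p, 'f, 'v) selection \<Rightarrow> ('p, 'f, 'v) query
    \<Rightarrow> ('p, 'f, 'v) step list set \<Rightarrow> bool" where
  "sld_tree P R Q T \<longleftrightarrow>
     [] \<in> T \<and>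
     (\<forall>ss s. ss @ [s] \<in> T \<longrightarrow> ss \<in> T \<and> sld_step P Q ss s \<and> selected s = R Q ss) \<and>
     (\<forall>ss \<in> T. last_query Q ss \<noteq> [] \<longrightarrow>
        (\<forall>c \<in> P. applicable c (last_query Q ss ! R Q ss) \<longrightarrow>
           (\<exists>!s. ss @ [s] \<in> T \<and> pclause s = c)))"

text \<open>\<open>Other\<close> admits further function symbols; an application determines its arity.\<close>

datatype 'f fsym = NilS | ConsS | MinusS | TrueS | FalseS | Other 'f

datatype psym = Sat_cnf | Sat_cl | Sat_cl3 | Sat_cl5 | Sat_cl5a | Eq | Sat | Tflist | Tf

abbreviation nil_t :: "('f fsym, 'v) trm" where
  "nil_t \<equiv> Fun NilS []"

abbreviation cons_t :: "('f fsym, 'v) trm \<Rightarrow> ('f fsym, 'v) trm \<Rightarrow> ('f fsym, 'v) trm" where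
  "cons_t h t \<equiv> Fun ConsS [h, t]"

abbreviation minus_t :: "('f fsym, 'v) trm \<Rightarrow> ('f fsym, 'v) trm \<Rightarrow> ('f fsym, 'v) trm" where
  "minus_t s s' \<equiv> Fun MinusS [s, s']"

fun list_t :: "('f fsym, 'v) trm list \<Rightarrow> ('f fsym, 'v) trm" where
  "list_t [] = nil_t"
| "list_t (t # ts) = cons_t t (list_t ts)"

definition is_list_of :: "(('f fsym, 'v) trm \<Rightarrow> bool) \<Rightarrow> ('f fsym, 'v) trm \<Rightarrow> bool" where
  "is_list_of E t \<longleftrightarrow> (\<exists>ts. t = list_t ts \<and> (\<forall>u \<in> set ts. E u))"

definition is_list :: "('f fsym, 'v) trm \<Rightarrow> bool" where
  "is_list t \<longleftrightarrow> (\<exists>ts. t = list_t ts)"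

definition is_pair :: "('f fsym, 'v) trm \<Rightarrow> bool" where
  "is_pair t \<longleftrightarrow> (\<exists>s s'. t = minus_t s s')"

definition P3 :: "(psym, 'f fsym, string) clause set" where
  "P3 =
    (let C = Var ''C''; Cs = Var ''Cs''; P = Var ''P''; V = Var ''V''; R = Var ''R'';
         X = Var ''X''; P1 = Var ''P1''; V1 = Var ''V1''; P2 = Var ''P2''; V2 = Var ''V2'';
         Vs = Var ''Vs''
     in
     {Clause (Atom Sat_cnf [nil_t]) [],
      Clause (Atom Sat_cnf [cons_t C Cs]) [Atom Sat_cl [C], Atom Sat_cnf [Cs]],
      Clause (Atom Sat_cl [cons_t (minus_t P V) R]) [Atom Sat_cl3 [R, V, P]],
      Clause (Atom Eq [X, X]) [],
      Clause (Atom Sat_cl3 [nil_t, V, P]) [Atom Eq [V, P]],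
      Clause (Atom Sat_cl3 [cons_t (minus_t P2 V2) R, V1, P1])
        [Atom Sat_cl5 [V1, P1, V2, P2, R]],
      Clause (Atom Sat_cl5 [V1, P1, V2, P2, R]) [Atom Sat_cl5a [V1, P1, V2, P2, R]],
      Clause (Atom Sat_cl5 [V1, P1, V2, P2, R]) [Atom Sat_cl5a [V2, P2, V1, P1, R]],
      Clause (Atom Sat_cl5a [V1, P1, V2, P2, R]) [Atom Eq [V1, P1]],
      Clause (Atom Sat_cl5a [V1, P1, V2, P2, R]) [Atom Sat_cl3 [R, V2, P2]],
      Clause (Atom Sat [Cs, Vs]) [Atom Sat_cnf [Cs], Atom Tflist [Vs]],
      Clause (Atom Tflist [nil_t]) [],
      Clause (Atom Tflist [cons_t V Vs]) [Atom Tflist [Vs], Atom Tf [V]],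
      Clause (Atom Tf [Fun TrueS []]) [],
      Clause (Atom Tf [Fun FalseS []]) []})"

end

theory Submission
  imports Defs
begin

text \<open>
  The length of a list, and the lengths of the elements of a list of lists, do not change under
  substitution.  Hence an atom whose relevant arguments are lists has a natural number weight
  that is invariant under instantiation, and the weights can be chosen so that in each instance
  of a clause of \<open>P3\<close> the total weight of the body is smaller than the weight of the head.
  So the weight of the initial query bounds the depth of the tree; a node has at most one child
  per program clause, so each level is finite.
\<close>

section \<open>Substitutions and standardizing apart\<close>

lemma subst_trm_comp: "subst_trm (subst_trm t \<sigma>) \<tau> = subst_trm t (subst_comp \<sigma> \<tau>)"
  by (induction t) (auto simp: subst_comp_def)

lemma subst_atom_comp: "subst_atom (subst_atom A \<sigma>) \<tau> = subst_atom A (subst_comp \<sigma> \<tau>)"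
  by (cases A) (simp add: subst_trm_comp)

lemma vars_subst_trm: "vars_trm (subst_trm t \<sigma>) \<subseteq> vars_trm t \<union> vars_subst \<sigma>"
proof (induction t)
  case (Var x)
  then show ?case
    by (cases "\<sigma> x = Var x") (auto simp: vars_subst_def subst_domain_def)
next
  case (Fun f ts)
  then show ?case by fastforce
qed

lemma vars_subst_atom: "vars_atom (subst_atom A \<sigma>) \<subseteq> vars_atom A \<union> vars_subst \<sigma>"
  using vars_subst_trm by (cases A) fastforce

lemma vars_subst_query: "vars_query (subst_query G \<sigma>) \<subseteq> vars_query G \<union> vars_subst \<sigma>"
  using vars_subst_atom by (fastforce simp: vars_query_def subst_query_def)

lemma vars_body: "vars_query (body c) \<subseteq> vars_clause c"
  by (cases c) (auto simp: vars_query_def)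

lemma last_query_simps [simp]:
  "last_query Q [] = Q"
  "last_query Q (ss @ [s]) = resolvent s"
  by (simp_all add: last_query_def)

text \<open>Inductive step of the invariant that the current query mentions only used variables. It
  is what lets freshness with respect to \<open>used_vars\<close> imply freshness with respect to
  the query.\<close>

lemma vars_resolvent_used:
  assumes step: "sld_step P Q ss s"
    and used: "vars_query (last_query Q ss) \<subseteq> used_vars Q ss"
  shows "vars_query (resolvent s) \<subseteq> used_vars Q (ss @ [s])"
proof -
  let ?G = "last_query Q ss" and ?i = "selected s"
  have "vars_query (resolvent s)
      \<subseteq> vars_query (take ?i ?G @ body (input s) @ drop (Suc ?i) ?G) \<union> vars_subst (mgu s)"
    using step vars_subst_query by (metis sld_step_def)
  also have "\<dots> \<subseteq> vars_query ?G \<union> vars_query (body (input s)) \<union> vars_subst (mgu s)"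
    by (auto simp: vars_query_def dest: in_set_takeD in_set_dropD)
  also have "\<dots> \<subseteq> used_vars Q (ss @ [s])"
    using used vars_body[of "input s"] by (auto simp: used_vars_def)
  finally show ?thesis .
qed

text \<open>The uniqueness condition in \<open>sld_tree\<close> speaks only of applicable clauses,
  so every edge has to be shown to carry one. The input clause and the mgu of the step itself are
  the witnesses.\<close>

lemma sld_step_applicable:
  assumes step: "sld_step P Q ss s"
    and used: "vars_query (last_query Q ss) \<subseteq> used_vars Q ss"
  shows "applicable (pclause s) (last_query Q ss ! selected s)"
proof -
  let ?A = "last_query Q ss ! selected s"
  have "?A \<in> set (last_query Q ss)"
    using step by (auto simp: sld_step_def Let_def)
  then have "vars_atom ?A \<subseteq> used_vars Q ss"
    using used by (auto simp: vars_query_def)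
  then show ?thesis
    using step unfolding applicable_def sld_step_def is_mgu_def Let_def by blast
qed

section \<open>Finiteness of SLD-trees of bounded depth\<close>

lemma sld_tree_extendD:
  assumes "sld_tree P R Q T" and "ss @ [s] \<in> T"
  shows "ss \<in> T" and "sld_step P Q ss s" and "selected s = R Q ss"
  using assms by (auto simp: sld_tree_def)

lemma vars_node_used:
  assumes "sld_tree P R Q T" and "ss \<in> T"
  shows "vars_query (last_query Q ss) \<subseteq> used_vars Q ss"
  using \<open>ss \<in> T\<close>
proof (induction ss rule: rev_induct)
  case Nil
  then show ?case by (simp add: used_vars_def)
next
  case (snoc s ss)
  then show ?case
    using sld_tree_extendD[OF assms(1)] vars_resolvent_used by fastforce
qed

text \<open>Among the children of a node, a step is determined by its program clause, so
  \<open>pclause\<close> embeds the children into \<open>P\<close>. This rules out infinite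
  branching through different renamings or mgus.\<close>

lemma finite_children:
  assumes tree: "sld_tree P R Q T" and "finite P"
  shows "finite {s. ss @ [s] \<in> T}"
proof (rule inj_on_finite[OF _ _ \<open>finite P\<close>])
  show "inj_on pclause {s. ss @ [s] \<in> T}"
  proof (rule inj_onI; simp)
    fix s s'
    assume s: "ss @ [s] \<in> T" and s': "ss @ [s'] \<in> T" and eq: "pclause s = pclause s'"
    note step = sld_tree_extendD[OF tree s]
    have "last_query Q ss \<noteq> []" and "pclause s \<in> P"
      using step(2) by (auto simp: sld_step_def Let_def)
    moreover have "applicable (pclause s) (last_query Q ss ! R Q ss)"
      using sld_step_applicable[OF step(2) vars_node_used[OF tree step(1)]] step(3) by simp
    ultimately have "\<exists>!s'. ss @ [s'] \<in> T \<and> pclause s' = pclause s"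
      using tree step(1) by (simp add: sld_tree_def)
    then show "s = s'"
      using s s' eq by metis
  qed
  show "pclause ` {s. ss @ [s] \<in> T} \<subseteq> P"
    using sld_tree_extendD(2)[OF tree] by (auto simp: sld_step_def Let_def)
qed

lemma finite_level:
  assumes tree: "sld_tree P R Q T" and "finite P"
  shows "finite {ss \<in> T. length ss = n}"
proof (induction n)
  case 0
  have "{ss \<in> T. length ss = 0} \<subseteq> {[]}" by auto
  then show ?case using finite_subset by blast
next
  case (Suc n)
  let ?children = "\<lambda>ss. (\<lambda>s. ss @ [s]) ` {s. ss @ [s] \<in> T}"
  have "{ss \<in> T. length ss = Suc n} \<subseteq> (\<Union>ss \<in> {ss \<in> T. length ss = n}. ?children ss)"
  proof
    fix ss assume "ss \<in> {ss \<in> T. length ss = Suc n}"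
    then have "ss \<in> T" and "length ss = Suc n" by auto
    then obtain ss' s where "ss = ss' @ [s]" and "length ss' = n"
      by (auto simp: length_Suc_conv_rev)
    with \<open>ss \<in> T\<close> show "ss \<in> (\<Union>ss \<in> {ss \<in> T. length ss = n}. ?children ss)"
      using sld_tree_extendD(1)[OF tree] by auto
  qed
  moreover have "finite (\<Union>ss \<in> {ss \<in> T. length ss = n}. ?children ss)"
    using Suc finite_children[OF assms] by auto
  ultimately show ?case by (rule finite_subset)
qed

lemma finite_sld_tree_if_bounded:
  assumes "sld_tree P R Q T" and "finite P" and bound: "\<And>ss. ss \<in> T \<Longrightarrow> length ss \<le> N"
  shows "finite T"
proof -
  have "T \<subseteq> (\<Union>n \<le> N. {ss \<in> T. length ss = n})"
    using bound by auto
  then show ?thesis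
    using finite_level[OF assms(1,2)] by (auto intro: finite_subset)
qed

section \<open>Weights of atoms\<close>

text \<open>A recursive counterpart of \<open>is_list_of\<close>, so that simplification can
  evaluate it on instances of clause heads.\<close>

fun proper_list :: "(('f fsym, 'v) trm \<Rightarrow> bool) \<Rightarrow> ('f fsym, 'v) trm \<Rightarrow> bool" where
  "proper_list E (Fun NilS []) \<longleftrightarrow> True"
| "proper_list E (Fun ConsS [h, t]) \<longleftrightarrow> E h \<and> proper_list E t"
| "proper_list E _ \<longleftrightarrow> False"

text \<open>The default 0 also covers a variable as tail, where instantiation could raise the
  weight; invariance is therefore claimed for proper lists only.\<close>

fun list_weight :: "(('f fsym, 'v) trm \<Rightarrow> nat) \<Rightarrow> ('f fsym, 'v) trm \<Rightarrow> nat" where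
  "list_weight w (Fun ConsS [h, t]) = w h + list_weight w t"
| "list_weight w _ = 0"

abbreviation "plain_list \<equiv> proper_list (\<lambda>_. True)"
abbreviation "nested_list \<equiv> proper_list plain_list"

definition list_len :: "('f fsym, 'v) trm \<Rightarrow> nat" where
  "list_len = list_weight (\<lambda>_. 1)"

definition nested_weight :: "('f fsym, 'v) trm \<Rightarrow> nat" where
  "nested_weight = list_weight (\<lambda>t. 3 * list_len t + 2)"

lemma proper_list_list_t: "proper_list E (list_t ts) \<longleftrightarrow> (\<forall>u \<in> set ts. E u)"
  by (induction ts) auto

lemma proper_list_subst:
  assumes "\<And>u. E u \<Longrightarrow> E (subst_trm u \<sigma>)"
  shows "proper_list E t \<Longrightarrow> proper_list E (subst_trm t \<sigma>)"
  using assms by (induction E t rule: proper_list.induct) auto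

text \<open>The spine of a proper list contains no variable, so a substitution acts only inside the
  elements.\<close>

lemma list_weight_subst:
  assumes "\<And>u. E u \<Longrightarrow> w (subst_trm u \<sigma>) = w u"
  shows "proper_list E t \<Longrightarrow> list_weight w (subst_trm t \<sigma>) = list_weight w t"
  using assms by (induction E t rule: proper_list.induct) auto

text \<open>List shape is asked of exactly those arguments that \<open>atom_weight\<close>
  measures.\<close>

fun well_shaped :: "(psym, 'f fsym, 'v) atom \<Rightarrow> bool" where
  "well_shaped (Atom p ts) = (case p of
     Sat \<Rightarrow> length ts = 2 \<and> nested_list (ts ! 0) \<and> plain_list (ts ! 1)
   | Sat_cnf \<Rightarrow> length ts = 1 \<and> nested_list (ts ! 0)
   | Sat_cl \<Rightarrow> length ts = 1 \<and> plain_list (ts ! 0)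
   | Sat_cl3 \<Rightarrow> length ts = 3 \<and> plain_list (ts ! 0)
   | Sat_cl5 \<Rightarrow> length ts = 5 \<and> plain_list (ts ! 4)
   | Sat_cl5a \<Rightarrow> length ts = 5 \<and> plain_list (ts ! 4)
   | Tflist \<Rightarrow> length ts = 1 \<and> plain_list (ts ! 0)
   | Eq \<Rightarrow> True
   | Tf \<Rightarrow> True)"

text \<open>The cycle \<open>Sat_cl3\<close>, \<open>Sat_cl5\<close>, \<open>Sat_cl5a\<close>,
  \<open>Sat_cl3\<close> takes three steps and consumes one list element, whence the factor 3; the
  offsets 4, 3, 2 order the predicates within a round. In \<open>Tflist\<close> each element pays
  for its own step and for one \<open>Tf\<close> atom, whence the factor 2.\<close>

fun atom_weight :: "(psym, 'f fsym, 'v) atom \<Rightarrow> nat" where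
  "atom_weight (Atom p ts) = (case p of
     Sat \<Rightarrow> nested_weight (ts ! 0) + 2 * list_len (ts ! 1) + 3
   | Sat_cnf \<Rightarrow> nested_weight (ts ! 0) + 1
   | Sat_cl \<Rightarrow> 3 * list_len (ts ! 0)
   | Sat_cl3 \<Rightarrow> 3 * list_len (ts ! 0) + 2
   | Sat_cl5 \<Rightarrow> 3 * list_len (ts ! 4) + 4
   | Sat_cl5a \<Rightarrow> 3 * list_len (ts ! 4) + 3
   | Tflist \<Rightarrow> 2 * list_len (ts ! 0) + 1
   | Eq \<Rightarrow> 1
   | Tf \<Rightarrow> 1)"

definition query_weight :: "(psym, 'f fsym, 'v) query \<Rightarrow> nat" where
  "query_weight G = sum_list (map atom_weight G)"

lemma plain_list_subst: "plain_list t \<Longrightarrow> plain_list (subst_trm t \<sigma>)"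
  by (rule proper_list_subst)

lemma nested_list_subst: "nested_list t \<Longrightarrow> nested_list (subst_trm t \<sigma>)"
  by (rule proper_list_subst[where E = plain_list]) (rule plain_list_subst)

lemma list_len_subst: "plain_list t \<Longrightarrow> list_len (subst_trm t \<sigma>) = list_len t"
  unfolding list_len_def by (rule list_weight_subst[where E = "\<lambda>_. True"]) simp_all

lemma nested_weight_subst: "nested_list t \<Longrightarrow> nested_weight (subst_trm t \<sigma>) = nested_weight t"
  unfolding nested_weight_def
  by (rule list_weight_subst[where E = plain_list]) (simp_all add: list_len_subst)

lemma well_shaped_subst: "well_shaped A \<Longrightarrow> well_shaped (subst_atom A \<sigma>)"
  by (cases A) (auto simp: plain_list_subst nested_list_subst split: psym.splits)

lemma atom_weight_subst: "well_shaped A \<Longrightarrow> atom_weight (subst_atom A \<sigma>) = atom_weight A"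
  by (cases A) (auto simp: list_len_subst nested_weight_subst split: psym.splits)

lemma query_weight_subst:
  "\<forall>A \<in> set G. well_shaped A \<Longrightarrow> query_weight (subst_query G \<sigma>) = query_weight G"
  by (induction G) (auto simp: query_weight_def subst_query_def atom_weight_subst)

section \<open>The weight decreases along derivations\<close>

text \<open>Stated for instances, because the variables in the clause text are not lists themselves:
  the shape of the head instance is what makes the body instance well shaped. Each clause then
  reduces to linear arithmetic.\<close>

lemma P3_clause_decreasing:
  assumes "c \<in> P3" and "well_shaped (subst_atom (head c) \<tau>)"
  shows "(\<forall>B \<in> set (body c). well_shaped (subst_atom B \<tau>)) \<and>
    query_weight (subst_query (body c) \<tau>) < atom_weight (subst_atom (head c) \<tau>)"
  using assms unfolding P3_def Let_def
  by (auto simp: query_weight_def subst_query_def list_len_def nested_weight_def numeral_eq_Suc)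

lemma P3_step_decreasing:
  assumes step: "sld_step P3 Q ss s" and shaped: "\<forall>A \<in> set (last_query Q ss). well_shaped A"
  shows "(\<forall>A \<in> set (resolvent s). well_shaped A) \<and>
    query_weight (resolvent s) < query_weight (last_query Q ss)"
proof -
  let ?i = "selected s" and ?\<theta> = "mgu s" and ?G = "last_query Q ss"
  let ?A = "?G ! ?i" and ?L = "take ?i ?G" and ?N = "drop (Suc ?i) ?G"
  have i: "?i < length ?G" and c: "pclause s \<in> P3"
    and unif: "subst_atom ?A ?\<theta> = subst_atom (head (input s)) ?\<theta>"
    and res: "resolvent s = subst_query (?L @ body (input s) @ ?N) ?\<theta>"
    using step by (auto simp: sld_step_def Let_def is_mgu_def is_unifier_def)
  obtain \<rho> where \<rho>: "input s = subst_clause (pclause s) \<rho>"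
    using step by (auto simp: sld_step_def Let_def is_variant_def)
  \<comment> \<open>Composing the renaming with the mgu makes the instantiated input clause an
    instance of the program clause itself.\<close>
  let ?\<tau> = "subst_comp \<rho> ?\<theta>"
  have head: "subst_atom (head (input s)) ?\<theta> = subst_atom (head (pclause s)) ?\<tau>"
    and body: "subst_query (body (input s)) ?\<theta> = subst_query (body (pclause s)) ?\<tau>"
    by (simp_all add: \<rho> subst_clause_def subst_query_def subst_atom_comp)
  have split: "?G = ?L @ ?A # ?N"
    by (rule id_take_nth_drop[OF i])
  have A: "well_shaped ?A" and LN: "\<forall>B \<in> set ?L \<union> set ?N. well_shaped B"
    using shaped i by (auto dest: in_set_takeD in_set_dropD)
  have "well_shaped (subst_atom (head (pclause s)) ?\<tau>)"
    using well_shaped_subst[OF A, of ?\<theta>] unif head by simp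
  note decr = P3_clause_decreasing[OF c this]
  \<comment> \<open>The mgu identifies the selected atom with the head instance and leaves its
    weight unchanged, so the clause bound applies to \<open>?A\<close>.\<close>
  have "query_weight (subst_query (body (input s)) ?\<theta>) < atom_weight ?A"
    using decr body unif head atom_weight_subst[OF A, of ?\<theta>] by simp
  moreover have "query_weight (resolvent s) =
      query_weight ?L + query_weight (subst_query (body (input s)) ?\<theta>) + query_weight ?N"
    using query_weight_subst[of ?L ?\<theta>] query_weight_subst[of ?N ?\<theta>] LN
    by (simp add: res query_weight_def subst_query_def)
  moreover have "query_weight ?G = query_weight ?L + atom_weight ?A + query_weight ?N"
    by (subst split) (simp add: query_weight_def)
  moreover have "\<forall>B \<in> set (resolvent s). well_shaped B"
  proof -
    have "resolvent s = subst_query ?L ?\<theta> @ subst_query (body (pclause s)) ?\<tau> @ subst_query ?N ?\<theta>"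
      by (simp add: res body[symmetric]) (simp add: subst_query_def)
    then show ?thesis
      using LN decr well_shaped_subst by (auto simp: subst_query_def)
  qed
  ultimately show ?thesis by linarith
qed

text \<open>Each step adds one to the length and takes at least one from the weight, so their sum
  never grows along a branch.\<close>

lemma P3_tree_node_weight:
  assumes tree: "sld_tree P3 R Q T" and Q: "\<forall>A \<in> set Q. well_shaped A" and "ss \<in> T"
  shows "(\<forall>A \<in> set (last_query Q ss). well_shaped A) \<and>
    length ss + query_weight (last_query Q ss) \<le> query_weight Q"
  using \<open>ss \<in> T\<close>
proof (induction ss rule: rev_induct)
  case Nil
  then show ?case using Q by simp
next
  case (snoc s ss)
  note step = sld_tree_extendD[OF tree snoc.prems]
  show ?case
    using snoc.IH[OF step(1)] P3_step_decreasing[OF step(2)] by auto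
qed

lemma finite_P3: "finite P3"
  by (simp add: P3_def Let_def)

theorem mainTheorem3:
  fixes t t' :: "('f fsym, string) trm"
    and R :: "(psym, 'f fsym, string) selection"
    and T :: "(psym, 'f fsym, string) step list set"
  assumes "is_list_of (is_list_of is_pair) t"
    and "is_list t'"
    and "selection_rule P3 R"
    and "sld_tree P3 R [Atom Sat [t, t']] T"
  shows "finite T"
proof (rule finite_sld_tree_if_bounded[OF assms(4) finite_P3])
  have "nested_list t" and "plain_list t'"
    using assms(1,2) by (fastforce simp: is_list_of_def is_list_def proper_list_list_t)+
  then have shaped: "\<forall>A \<in> set [Atom Sat [t, t']]. well_shaped A"
    by simp
  show "length ss \<le> query_weight [Atom Sat [t, t']]" if "ss \<in> T" for ss
    using P3_tree_node_weight[OF assms(4) shaped that] by linarith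
qed

end
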